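(* For integers $k\geq 2$ and $n\geq 4$, \[ \mathrm{R}_k(W_n)\leq k\bigl(\mathrm{R}(C_{n-1}, \underbrace{W_n, \ldots , W_n}_{k-1})-1\bigr)+2 \leq k\bigl(\mathrm{R}(C_{n-1},K_{\mathrm{R}_{k-1}(W_n)})-1\bigr)+2, \] and moreover \[ \mathrm{R}_k(W_n)\leq k\left(\frac{n-3}{2}\mathrm{R}_{k-1}(W_n)\cdot (\mathrm{R}_{k-1}(W_n)-1)+\mathrm{R}_{k-1}(W_n)-1\right)+2. \]
   Context: For an integer $n\geq 4$, the wheel $W_n$ is the graph on $n$ vertices obtained from the cycle $C_{n-1}$ by adding one new vertex adjacent to every vertex of the cycle; $C_m$ is the cycle of length $m$ and $K_m$ the complete graph on $m$ vertices. For graphs $G_1,\ldots,G_k$, $\mathrm{R}(G_1,\ldots,G_k)$ is the smallest integer $N$ such that for every coloring of the edges of $K_N$ with colors $1,\ldots,k$ there is some $i$ and a copy of $G_i$ all of whose edges have color $i$. $\mathrm{R}_k(G)$ denotes $\mathrm{R}(G,\ldots,G)$ with $k$ copies of $G$; in particular $\mathrm{R}(C_{n-1},K_t)$ is the two-color Ramsey number. *)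

theory Defs
  imports Complex_Main "HOL-Library.Ramsey"
begin

text \<open>
  Simple graphs are given by a vertex set and a set of two-element subsets of it. HOL-Library
  provides \<^term>\<open>nsets V 2\<close> for the two-element subsets of \<^term>\<open>V\<close>, that is, the edge set of
  the complete graph on \<^term>\<open>V\<close>.
\<close>

record 'a sgraph =
  verts :: "'a set"
  edges :: "'a set set"

definition fin_sgraph :: "'a sgraph \<Rightarrow> bool" where
  "fin_sgraph G \<longleftrightarrow> finite (verts G) \<and> edges G \<subseteq> nsets (verts G) 2"

definition complete_graph :: "nat \<Rightarrow> nat sgraph" where
  "complete_graph m = \<lparr> verts = {..<m}, edges = nsets {..<m} 2 \<rparr>"

text \<open>This is the cycle of length \<^term>\<open>m\<close> for \<^term>\<open>m \<ge> 3\<close> only; smaller values are never used.\<close>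

definition cycle_graph :: "nat \<Rightarrow> nat sgraph" where
  "cycle_graph m = \<lparr> verts = {..<m}, edges = {{i, Suc i mod m} |i. i < m} \<rparr>"

text \<open>
  The wheel has \<^term>\<open>n\<close> vertices in total: the rim is a cycle of length \<^term>\<open>n - 1\<close> on
  the vertices below \<^term>\<open>n - 1\<close>, and the hub is the vertex \<^term>\<open>n - 1\<close>.
\<close>

definition wheel_graph :: "nat \<Rightarrow> nat sgraph" where
  "wheel_graph n = \<lparr> verts = {..<n},
     edges = edges (cycle_graph (n - 1)) \<union> {{i, n - 1} |i. i < n - 1} \<rparr>"

text \<open>Copies are subgraphs, not necessarily induced ones.\<close>

definition contains_copy :: "'b sgraph \<Rightarrow> 'a sgraph \<Rightarrow> bool" where
  "contains_copy H G \<longleftrightarrow>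
     (\<exists>\<phi>. inj_on \<phi> (verts G) \<and> \<phi> ` verts G \<subseteq> verts H \<and> (\<forall>e \<in> edges G. \<phi> ` e \<in> edges H))"

text \<open>
  For an edge colouring \<^term>\<open>f\<close> of the complete graph on \<^term>\<open>N\<close> vertices, the spanning subgraph
  consisting of the edges of colour \<^term>\<open>i\<close>.
\<close>

definition colour_class :: "nat \<Rightarrow> (nat set \<Rightarrow> nat) \<Rightarrow> nat \<Rightarrow> nat sgraph" where
  "colour_class N f i =
     \<lparr> verts = {..<N}, edges = {e \<in> edges (complete_graph N). f e = i} \<rparr>"

text \<open>The \<^term>\<open>k\<close> colours are \<open>0, \<dots>, k - 1\<close>, where \<^term>\<open>k\<close> is the length of the list of graphs.\<close>

definition arrows :: "nat \<Rightarrow> 'a sgraph list \<Rightarrow> bool" where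
  "arrows N Gs \<longleftrightarrow>
     (\<forall>f \<in> edges (complete_graph N) \<rightarrow> {..<length Gs}.
        \<exists>i < length Gs. contains_copy (colour_class N f i) (Gs ! i))"

definition ramsey_number :: "'a sgraph list \<Rightarrow> nat" where
  "ramsey_number Gs = (LEAST N. arrows N Gs)"

definition diag_ramsey_number :: "nat \<Rightarrow> 'a sgraph \<Rightarrow> nat" where
  "diag_ramsey_number k G = ramsey_number (replicate k G)"

text \<open>By Ramsey's theorem the minimum exists for finite graphs.\<close>

lemma arrows_ramsey_number:
  assumes "\<And>G. G \<in> set Gs \<Longrightarrow> fin_sgraph G"
  shows "arrows (ramsey_number Gs) Gs"
proof -
  obtain N :: nat where N: "partn_lst {..<N} (map (\<lambda>G. card (verts G)) Gs) 2"
    using ramsey_full by blast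
  have "arrows N Gs"
    unfolding arrows_def
  proof
    fix f assume "f \<in> edges (complete_graph N) \<rightarrow> {..<length Gs}"
    then obtain i where i: "i < length Gs"
      and "monochromatic {..<N} (card (verts (Gs ! i))) 2 f i"
      using N by (auto simp: partn_lst_def complete_graph_def)
    then obtain H where H: "H \<in> nsets {..<N} (card (verts (Gs ! i)))" "f ` nsets H 2 \<subseteq> {i}"
      unfolding monochromatic_def by blast
    have G: "finite (verts (Gs ! i))" "edges (Gs ! i) \<subseteq> nsets (verts (Gs ! i)) 2"
      using assms[of "Gs ! i"] i by (auto simp: fin_sgraph_def)
    obtain \<phi> where \<phi>: "bij_betw \<phi> (verts (Gs ! i)) H"
      using finite_same_card_bij[of "verts (Gs ! i)" H] H(1) G(1) by (auto simp: nsets_def)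
    have "\<phi> ` e \<in> edges (colour_class N f i)" if "e \<in> edges (Gs ! i)" for e
    proof -
      have "\<phi> ` e \<in> nsets H 2"
        using that G(2) \<phi> bij_betw_nsets[OF \<phi>, of 2] unfolding bij_betw_def by blast
      moreover have "nsets H 2 \<subseteq> nsets {..<N} 2"
        using H(1) by (intro nsets_mono) (auto simp: nsets_def)
      ultimately show ?thesis
        using H(2) by (auto simp: colour_class_def complete_graph_def)
    qed
    moreover have "inj_on \<phi> (verts (Gs ! i))" "\<phi> ` verts (Gs ! i) \<subseteq> verts (colour_class N f i)"
      using \<phi> H(1) by (auto simp: bij_betw_def colour_class_def nsets_def)
    ultimately show "\<exists>i < length Gs. contains_copy (colour_class N f i) (Gs ! i)"
      using i unfolding contains_copy_def by blast
  qed
  then show ?thesis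
    unfolding ramsey_number_def by (rule LeastI)
qed

lemma fin_sgraph_complete: "fin_sgraph (complete_graph m)"
  by (simp add: fin_sgraph_def complete_graph_def)

lemma fin_sgraph_cycle:
  assumes "m \<ge> 3" shows "fin_sgraph (cycle_graph m)"
proof -
  have "{i, Suc i mod m} \<in> nsets {..<m} 2" if "i < m" for i
  proof (cases "Suc i = m")
    case True
    then show ?thesis using assms by simp
  next
    case False
    then show ?thesis using that by simp
  qed
  then show ?thesis
    unfolding fin_sgraph_def cycle_graph_def by fastforce
qed

lemma fin_sgraph_wheel:
  assumes "n \<ge> 4" shows "fin_sgraph (wheel_graph n)"
proof -
  have "edges (cycle_graph (n - 1)) \<subseteq> nsets {..<n - 1} 2"
    using fin_sgraph_cycle[of "n - 1"] assms by (simp add: fin_sgraph_def cycle_graph_def)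
  also have "\<dots> \<subseteq> nsets {..<n} 2"
    by (intro nsets_mono) auto
  finally show ?thesis
    using assms by (auto simp: fin_sgraph_def wheel_graph_def)
qed

end

theory Submission
  imports Defs
begin

text \<open>
  If \<open>N - 1 > k (r - 1)\<close> with \<open>r = R(C\<^bsub>n-1\<^esub>, W\<^bsub>n\<^esub>, \<dots>, W\<^bsub>n\<^esub>)\<close>, then some vertex \<open>v\<close>
  has at least \<open>r\<close> neighbours in one colour \<open>i\<close>; among them there is a monochromatic wheel in
  another colour, or a cycle in colour \<open>i\<close>, which \<open>v\<close> completes to a wheel. Merging all colours but
  the first bounds \<open>r\<close> by \<open>R(C\<^bsub>n-1\<^esub>, K\<^bsub>t\<^esub>)\<close>. Finally
  \<open>R(C\<^bsub>m\<^esub>, K\<^bsub>t+1\<^esub>) \<le> R(C\<^bsub>m\<^esub>, K\<^bsub>t\<^esub>) + (m - 2) t + 1\<close>: a vertex with more than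
  \<open>(m - 2) t\<close> neighbours sees an independent set of size \<open>t + 1\<close> or a path on \<open>m - 1\<close> vertices,
  which it closes to a cycle, while a vertex of smaller degree can be added to an independent set
  among its non-neighbours.
\<close>

section \<open>Colour classes on arbitrary vertex sets\<close>

text \<open>\<open>colour_class\<close> is tied to an initial segment of the naturals; the arguments
  below also colour neighbourhoods and images of complete graphs.\<close>

definition mono_graph :: "'a set \<Rightarrow> ('a set \<Rightarrow> nat) \<Rightarrow> nat \<Rightarrow> 'a sgraph" where
  "mono_graph V f i = \<lparr> verts = V, edges = {e \<in> nsets V 2. f e = i} \<rparr>"

lemma colour_class_eq_mono_graph: "colour_class N f i = mono_graph {..<N} f i"
  by (simp add: colour_class_def mono_graph_def complete_graph_def)

lemma contains_copy_mono:
  assumes "contains_copy H G" "verts H \<subseteq> verts H'" "edges H \<subseteq> edges H'"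
  shows "contains_copy H' G"
  using assms unfolding contains_copy_def by (meson order_trans subsetD)

text \<open>Carries a copy found under a recolouring \<open>g\<close> of a smaller vertex set back
  to \<open>f\<close>; the recolourings used below permute, merge or shift colours.\<close>

lemma contains_copy_mono_graph_subset:
  assumes "contains_copy (mono_graph U g j) G" "U \<subseteq> V"
    and "\<And>e. e \<in> nsets U 2 \<Longrightarrow> g e = j \<Longrightarrow> f e = i"
  shows "contains_copy (mono_graph V f i) G"
  using assms(1)
  by (rule contains_copy_mono) (use assms(2,3) nsets_mono[OF assms(2), of 2] in
      \<open>auto simp: mono_graph_def\<close>)

lemma contains_copy_cycle_iff:
  "contains_copy H (cycle_graph m) \<longleftrightarrow>
     (\<exists>c. inj_on c {..<m} \<and> c ` {..<m} \<subseteq> verts H \<and> (\<forall>i<m. {c i, c (Suc i mod m)} \<in> edges H))"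
proof -
  have "(\<forall>e \<in> edges (cycle_graph m). c ` e \<in> edges H) \<longleftrightarrow>
      (\<forall>i<m. c ` {i, Suc i mod m} \<in> edges H)" for c :: "nat \<Rightarrow> 'a"
    unfolding cycle_graph_def by (simp only: sgraph.select_convs) blast
  then show ?thesis
    unfolding contains_copy_def by (simp add: cycle_graph_def)
qed

text \<open>An injection of \<open>{..<N}\<close> into \<open>V\<close> pulls \<open>f\<close> back
  to a colouring of \<open>complete_graph N\<close> and pushes the copy found there forward.\<close>

lemma arrows_on_finite_set:
  assumes "arrows N Gs" "finite V" "N \<le> card V" "f \<in> nsets V 2 \<rightarrow> {..<length Gs}"
  shows "\<exists>i < length Gs. contains_copy (mono_graph V f i) (Gs ! i)"
proof -
  obtain g where g: "g ` {..<N} \<subseteq> V" "inj_on g {..<N}"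
    using card_le_inj[of "{..<N}" V] assms(2,3) by auto
  have im: "g ` e \<in> nsets V 2" if "e \<in> nsets {..<N} 2" for e
    using that g by (auto simp: nsets_def card_image inj_on_subset)
  then have "(\<lambda>e. f (g ` e)) \<in> edges (complete_graph N) \<rightarrow> {..<length Gs}"
    using assms(4) by (auto simp: complete_graph_def)
  then obtain i \<phi> where i: "i < length Gs" and inj: "inj_on \<phi> (verts (Gs ! i))"
    and sub: "\<phi> ` verts (Gs ! i) \<subseteq> {..<N}"
    and ed: "\<And>e. e \<in> edges (Gs ! i) \<Longrightarrow> \<phi> ` e \<in> nsets {..<N} 2 \<and> f (g ` \<phi> ` e) = i"
    using assms(1) unfolding arrows_def contains_copy_def colour_class_eq_mono_graph
    by (fastforce simp: mono_graph_def)
  have "inj_on (g \<circ> \<phi>) (verts (Gs ! i))"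
    using inj sub g(2) by (meson comp_inj_on inj_on_subset)
  moreover have "(g \<circ> \<phi>) ` verts (Gs ! i) \<subseteq> V"
    using sub g(1) by fastforce
  moreover have "(g \<circ> \<phi>) ` e \<in> {e \<in> nsets V 2. f e = i}" if "e \<in> edges (Gs ! i)" for e
    using ed[OF that] im[of "\<phi> ` e"] by (simp add: image_comp)
  ultimately have "contains_copy (mono_graph V f i) (Gs ! i)"
    unfolding contains_copy_def mono_graph_def by (intro exI[of _ "g \<circ> \<phi>"]) simp
  then show ?thesis
    using i by blast
qed

lemma ramsey_number_le: "arrows N Gs \<Longrightarrow> ramsey_number Gs \<le> N"
  unfolding ramsey_number_def by (rule Least_le)

text \<open>Without vertices there are no edges, so every function, even \<open>undefined\<close>,
  is a colouring, yet no graph with a vertex embeds.\<close>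

lemma arrows_pos:
  assumes "arrows N Gs" "\<And>G. G \<in> set Gs \<Longrightarrow> verts G \<noteq> {}"
  shows "N > 0"
proof (rule ccontr)
  assume "\<not> N > 0"
  then have "edges (complete_graph N) = {}"
    by (auto simp: complete_graph_def nsets_def)
  then obtain i where "i < length Gs" "contains_copy (colour_class N undefined i) (Gs ! i)"
    using assms(1) unfolding arrows_def by fastforce
  then show False
    using \<open>\<not> N > 0\<close> assms(2)[of "Gs ! i"] by (auto simp: contains_copy_def colour_class_def)
qed

section \<open>From cycles in a neighbourhood to wheels\<close>

lemma contains_wheel_of_cycle:
  assumes "n \<ge> 4" "contains_copy (mono_graph U f i) (cycle_graph (n - 1))" "U \<subseteq> V"
    and v: "v \<in> V" "v \<notin> U" and spoke: "\<And>u. u \<in> U \<Longrightarrow> f {v, u} = i"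
  shows "contains_copy (mono_graph V f i) (wheel_graph n)"
proof -
  obtain c where inj: "inj_on c {..<n - 1}" and sub: "c ` {..<n - 1} \<subseteq> U"
    and ed: "\<And>j. j < n - 1 \<Longrightarrow>
      {c j, c (Suc j mod (n - 1))} \<in> nsets U 2 \<and> f {c j, c (Suc j mod (n - 1))} = i"
    using assms(2) unfolding contains_copy_cycle_iff by (auto simp: mono_graph_def)
  \<comment> \<open>\<open>wheel_graph\<close> has its hub at index \<open>n - 1\<close>, just past
    the rim, so \<open>d\<close> keeps the cycle as the rim and sends the hub to
    \<open>v\<close>.\<close>
  define d where "d = c(n - 1 := v)"
  have n: "{..<n} = insert (n - 1) {..<n - 1}"
    using assms(1) by auto
  have d: "d (n - 1) = v" "\<And>j. j < n - 1 \<Longrightarrow> d j = c j"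
    by (auto simp: d_def)
  have dim: "d ` {..<n - 1} = c ` {..<n - 1}"
    using d by auto
  have "inj_on d {..<n - 1}"
    using inj d by (auto simp: inj_on_def)
  then have "inj_on d {..<n}"
    unfolding n using sub dim d v by auto
  moreover have "d ` {..<n} \<subseteq> V"
    unfolding n using sub dim d v assms(3) by auto
  moreover have "d ` e \<in> {e \<in> nsets V 2. f e = i}" if "e \<in> edges (wheel_graph n)" for e
  proof -
    from that consider j where "j < n - 1" "e = {j, Suc j mod (n - 1)}"
      | j where "j < n - 1" "e = {j, n - 1}"
      by (auto simp: wheel_graph_def cycle_graph_def)
    then show ?thesis
    proof cases
      case 1
      then have "d ` e = {c j, c (Suc j mod (n - 1))}"
        using d(2)[of j] d(2)[of "Suc j mod (n - 1)"] assms(1) by simp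
      then show ?thesis
        using ed[OF 1(1)] nsets_mono[OF assms(3), of 2] by (simp only: mem_Collect_eq) blast
    next
      case 2
      then have "d ` e = {v, c j}" "c j \<in> U"
        using d sub by auto
      then show ?thesis
        using spoke[of "c j"] v assms(3) by auto
    qed
  qed
  ultimately show ?thesis
    unfolding contains_copy_def by (intro exI[of _ d]) (simp add: mono_graph_def wheel_graph_def)
qed

lemma pigeonhole_fibre:
  fixes g :: "'a \<Rightarrow> nat"
  assumes "finite A" "g ` A \<subseteq> {..<k}" "k * b < card A"
  shows "\<exists>i<k. b < card {x \<in> A. g x = i}"
proof (rule ccontr)
  assume "\<not> ?thesis"
  then have "(\<Sum>i<k. card {x \<in> A. g x = i}) \<le> (\<Sum>i<k. b)"
    by (intro sum_mono) (meson lessThan_iff not_less)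
  moreover have "card A = (\<Sum>i<k. card {x \<in> A. g x = i})"
    using sum.group[of A "{..<k}" g "\<lambda>_. 1::nat"] assms by simp
  ultimately show False
    using assms(3) by simp
qed

text \<open>Of the two extra vertices, one is the centre and one makes the pigeonhole count strict.
  Writing \<open>Suc b\<close> avoids truncated subtraction.\<close>

lemma arrows_wheel_of_cycle:
  assumes "n \<ge> 4" "k > 0"
    and r: "arrows (Suc b) (cycle_graph (n - 1) # replicate (k - 1) (wheel_graph n))"
  shows "arrows (k * b + 2) (replicate k (wheel_graph n))"
  unfolding arrows_def
proof
  let ?N = "k * b + 2" and ?Gs = "cycle_graph (n - 1) # replicate (k - 1) (wheel_graph n)"
  fix f assume "f \<in> edges (complete_graph ?N) \<rightarrow> {..<length (replicate k (wheel_graph n))}"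
  then have f: "f e < k" if "e \<in> nsets {..<?N} 2" for e
    using that by (auto simp: complete_graph_def)
  \<comment> \<open>Vertex 0 has \<open>k * b + 1\<close> neighbours, so one colour reaches at least
    \<open>Suc b\<close> of them.\<close>
  have "\<exists>i<k. b < card {u \<in> {1..<?N}. f {0, u} = i}"
    by (rule pigeonhole_fibre) (auto intro!: f)
  then obtain i where i: "i < k" "b < card {u \<in> {1..<?N}. f {0, u} = i}"
    by blast
  define U where "U = {u \<in> {1..<?N}. f {0, u} = i}"
  have U: "U \<subseteq> {..<?N}" "0 \<notin> U" "finite U"
    by (auto simp: U_def)
  \<comment> \<open>The cycle sits at position 0 of \<open>?Gs\<close>, while the popular colour is
    \<open>i\<close>; the transposition \<open>\<tau>\<close> makes the two match.\<close>
  define \<tau> :: "nat \<Rightarrow> nat" where "\<tau> = (\<lambda>c. if c = 0 then i else if c = i then 0 else c)"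
  have \<tau>: "\<tau> (\<tau> c) = c" for c
    by (simp add: \<tau>_def)
  have len: "length ?Gs = k"
    using assms(2) by simp
  have "(\<lambda>e. \<tau> (f e)) \<in> nsets U 2 \<rightarrow> {..<length ?Gs}"
    unfolding len using f nsets_mono[OF U(1), of 2] i(1) by (auto simp: \<tau>_def)
  then obtain j where j: "j < k" "contains_copy (mono_graph U (\<lambda>e. \<tau> (f e)) j) (?Gs ! j)"
    using arrows_on_finite_set[OF r U(3)] i(2) len by (auto simp: U_def)
  \<comment> \<open>As \<open>\<tau>\<close> is an involution, an edge has new colour
    \<open>j\<close> only if its colour under \<open>f\<close> is \<open>\<tau> j\<close>.\<close>
  have copy: "contains_copy (mono_graph V f (\<tau> j)) (?Gs ! j)" if "U \<subseteq> V" for V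
    by (rule contains_copy_mono_graph_subset[OF j(2) that]) (metis \<tau>)
  have "\<exists>i<k. contains_copy (mono_graph {..<?N} f i) (wheel_graph n)"
  proof (cases "j = 0")
    case True
    have "contains_copy (mono_graph {..<?N} f i) (wheel_graph n)"
      by (rule contains_wheel_of_cycle[OF assms(1) _ U(1) _ U(2)])
        (use copy[of U] True in \<open>auto simp: \<tau>_def U_def\<close>)
    then show ?thesis
      using i(1) by blast
  next
    case False
    then have "?Gs ! j = wheel_graph n" "\<tau> j < k"
      using j(1) i(1) by (auto simp: \<tau>_def nth_Cons')
    then show ?thesis
      using copy[OF U(1)] by auto
  qed
  then show "\<exists>i<length (replicate k (wheel_graph n)).
      contains_copy (colour_class ?N f i) (replicate k (wheel_graph n) ! i)"
    by (auto simp: colour_class_eq_mono_graph)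
qed

section \<open>Merging all colours but the first\<close>

text \<open>A complete graph on \<open>t\<close> vertices in the merged colour carries only nonzero
  original colours; shifted down by one, they colour it for \<open>Gs\<close>.\<close>

lemma arrows_merge_colours:
  assumes N: "arrows N [G, complete_graph t]" and t: "arrows t Gs"
  shows "arrows N (G # Gs)"
  unfolding arrows_def
proof
  fix f assume "f \<in> edges (complete_graph N) \<rightarrow> {..<length (G # Gs)}"
  then have f: "f e < Suc (length Gs)" if "e \<in> nsets {..<N} 2" for e
    using that by (auto simp: complete_graph_def)
  define g :: "nat set \<Rightarrow> nat" where "g = (\<lambda>e. if f e = 0 then 0 else 1)"
  have "g \<in> nsets {..<N} 2 \<rightarrow> {..<length [G, complete_graph t]}"
    by (auto simp: g_def)
  then obtain i where i: "i < 2" "contains_copy (mono_graph {..<N} g i) ([G, complete_graph t] ! i)"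
    using arrows_on_finite_set[OF N, of "{..<N}"] by (auto simp: numeral_2_eq_2)
  have "\<exists>i<Suc (length Gs). contains_copy (mono_graph {..<N} f i) ((G # Gs) ! i)"
  proof (cases "i = 0")
    case True
    have "contains_copy (mono_graph {..<N} f 0) G"
      by (rule contains_copy_mono_graph_subset[of "{..<N}" g 0])
        (use i True in \<open>auto simp: g_def split: if_splits\<close>)
    then show ?thesis
      by auto
  next
    case False
    then have "i = 1"
      using i(1) by simp
    then obtain \<phi> where inj: "inj_on \<phi> {..<t}" and sub: "\<phi> ` {..<t} \<subseteq> {..<N}"
      and ed: "\<And>e. e \<in> nsets {..<t} 2 \<Longrightarrow> g (\<phi> ` e) = 1"
      using i(2) by (auto simp: contains_copy_def complete_graph_def mono_graph_def)
    \<comment> \<open>Truncated subtraction would identify colours 0 and 1, so the shift needs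
      nonzero colours throughout the image.\<close>
    have pos: "f e > 0" if e: "e \<in> nsets (\<phi> ` {..<t}) 2" for e
    proof -
      have "bij_betw \<phi> {..<t} (\<phi> ` {..<t})"
        using inj by (simp add: bij_betw_def)
      from bij_betw_nsets[OF this, of 2] e obtain e' where "e' \<in> nsets {..<t} 2" "e = \<phi> ` e'"
        unfolding bij_betw_def by blast
      then show ?thesis
        using ed[of e'] by (auto simp: g_def split: if_splits)
    qed
    have "(\<lambda>e. f e - 1) \<in> nsets (\<phi> ` {..<t}) 2 \<rightarrow> {..<length Gs}"
      using f nsets_mono[OF sub, of 2] pos by fastforce
    then obtain j where j: "j < length Gs"
        "contains_copy (mono_graph (\<phi> ` {..<t}) (\<lambda>e. f e - 1) j) (Gs ! j)"
      using arrows_on_finite_set[OF t, of "\<phi> ` {..<t}"] inj by (auto simp: card_image)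
    have "contains_copy (mono_graph {..<N} f (Suc j)) (Gs ! j)"
      by (rule contains_copy_mono_graph_subset[OF j(2) sub]) (use pos in fastforce)
    then show ?thesis
      using j(1) by auto
  qed
  then show "\<exists>i<length (G # Gs). contains_copy (colour_class N f i) ((G # Gs) ! i)"
    by (simp add: colour_class_eq_mono_graph)
qed

section \<open>Paths and independent sets\<close>

text \<open>\<open>s\<close> counts vertices, not edges. \<open>E\<close> may contain edges leaving
  \<open>V\<close>, so inductions can shrink \<open>V\<close> and keep \<open>E\<close>.\<close>

definition is_path :: "'a set \<Rightarrow> 'a set set \<Rightarrow> nat \<Rightarrow> (nat \<Rightarrow> 'a) \<Rightarrow> bool" where
  "is_path V E s p \<longleftrightarrow>
     inj_on p {..<s} \<and> p ` {..<s} \<subseteq> V \<and> (\<forall>i. Suc i < s \<longrightarrow> {p i, p (Suc i)} \<in> E)"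

text \<open>\<open>E\<close> is an arbitrary family of sets and may contain \<open>{v}\<close>, to
  which \<open>{v, u}\<close> collapses at \<open>u = v\<close>; hence \<open>v\<close> is removed
  explicitly.\<close>

definition nbrs :: "'a set \<Rightarrow> 'a set set \<Rightarrow> 'a \<Rightarrow> 'a set" where
  "nbrs V E v = {u \<in> V - {v}. {v, u} \<in> E}"

text \<open>Greedy extension: the vertices already on the path are too few to exhaust the neighbours
  of its last vertex.\<close>

lemma path_of_min_degree:
  assumes "finite V" "V \<noteq> {}" "\<And>v. v \<in> V \<Longrightarrow> s \<le> card (nbrs V E v)" "j \<le> s"
  shows "\<exists>p. is_path V E (Suc j) p"
  using assms(4)
proof (induction j)
  case 0
  obtain v where "v \<in> V"
    using assms(2) by blast
  then have "is_path V E (Suc 0) (\<lambda>_. v)"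
    by (auto simp: is_path_def inj_on_def)
  then show ?case
    by blast
next
  case (Suc j)
  then obtain p where p: "is_path V E (Suc j) p"
    by auto
  have sub: "p ` {..<Suc j} \<subseteq> V" and inj: "inj_on p {..<Suc j}"
    using p by (auto simp: is_path_def)
  \<comment> \<open>\<open>p j\<close> is not its own neighbour, so only the \<open>j < s\<close>
    vertices before it can block the extension.\<close>
  have "card (p ` {..<j}) < card (nbrs V E (p j))"
    using card_image_le[of "{..<j}" p] assms(3)[of "p j"] sub Suc.prems by auto
  then have "\<not> nbrs V E (p j) \<subseteq> p ` {..<j}"
    using card_mono[of "p ` {..<j}" "nbrs V E (p j)"] by auto
  then obtain u where u: "u \<in> V" "u \<noteq> p j" "{p j, u} \<in> E" "u \<notin> p ` {..<j}"
    by (auto simp: nbrs_def)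
  define q where "q = p(Suc j := u)"
  have q: "q (Suc j) = u" "\<And>i. i < Suc j \<Longrightarrow> q i = p i"
    by (auto simp: q_def)
  have qim: "q ` {..<Suc j} = p ` {..<Suc j}"
    using q by auto
  have "inj_on q {..<Suc j}"
    using inj q by (auto simp: inj_on_def)
  moreover have "u \<notin> p ` {..<Suc j}"
    using u by (auto simp: lessThan_Suc)
  ultimately have "inj_on q {..<Suc (Suc j)}"
    unfolding lessThan_Suc[of "Suc j"] using q(1) qim by auto
  moreover have "q ` {..<Suc (Suc j)} \<subseteq> V"
    unfolding lessThan_Suc[of "Suc j"] using q(1) qim sub u(1) by auto
  moreover have "{q i, q (Suc i)} \<in> E" if "Suc i < Suc (Suc j)" for i
  proof (cases "i = j")
    case True
    then show ?thesis
      using q u(3) by auto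
  next
    case False
    then show ?thesis
      using that q p by (auto simp: is_path_def)
  qed
  ultimately have "is_path V E (Suc (Suc j)) q"
    by (simp add: is_path_def)
  then show ?case
    by blast
qed

lemma independent_insert:
  assumes "finite V" "v \<in> V" "S \<in> nsets (V - {v} - nbrs V E v) t" "nsets S 2 \<inter> E = {}"
  shows "insert v S \<in> nsets V (Suc t)" "nsets (insert v S) 2 \<inter> E = {}"
proof -
  have S: "S \<subseteq> V" "v \<notin> S" "finite S" "card S = t" "\<And>u. u \<in> S \<Longrightarrow> {v, u} \<notin> E"
    using assms(3) by (auto simp: nsets_def nbrs_def)
  then show "insert v S \<in> nsets V (Suc t)"
    using assms(2) by (auto simp: nsets_def)
  have "e \<notin> E" if e: "e \<in> nsets (insert v S) 2" for e
  proof (cases "v \<in> e")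
    case True
    then obtain u where "e = {v, u}" "u \<in> S"
      using e unfolding nsets_2_eq by auto
    then show ?thesis
      using S(5) by simp
  next
    case False
    then have "e \<in> nsets S 2"
      using that by (auto simp: nsets_def)
    then show ?thesis
      using assms(4) by auto
  qed
  then show "nsets (insert v S) 2 \<inter> E = {}"
    by auto
qed

lemma card_nonnbrs:
  assumes "finite V" "v \<in> V"
  shows "card V = Suc (card (nbrs V E v) + card (V - {v} - nbrs V E v))"
proof -
  have "nbrs V E v \<subseteq> V - {v}"
    by (auto simp: nbrs_def)
  then have "card (V - {v}) = card (nbrs V E v) + card (V - {v} - nbrs V E v)"
    using assms(1) by (metis card_Diff_subset card_mono finite_Diff finite_subset le_add_diff_inverse)
  then show ?thesis
    using assms card_Suc_Diff1[of V v] by simp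
qed

text \<open>If all degrees are at least \<open>s\<close>, the greedy path exists; otherwise a vertex
  of smaller degree joins an independent set among its non-neighbours. This is the path case of the
  upper bound in Chvatal's theorem on trees versus complete graphs.\<close>

lemma path_or_independent:
  assumes "finite V" "s * t < card V"
  shows "(\<exists>p. is_path V E (Suc s) p) \<or> (\<exists>S \<in> nsets V (Suc t). nsets S 2 \<inter> E = {})"
  using assms
proof (induction t arbitrary: V)
  case 0
  then obtain v where "v \<in> V"
    by fastforce
  then have "{v} \<in> nsets V (Suc 0)" "nsets {v} 2 \<inter> E = {}"
    by (auto simp: nsets_def subset_singleton_iff)
  then show ?case
    by blast
next
  case (Suc t)
  show ?case
  proof (cases "\<forall>v\<in>V. s \<le> card (nbrs V E v)")
    case True
    have "V \<noteq> {}"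
      using Suc.prems(2) by auto
    then show ?thesis
      using path_of_min_degree[of V s E s] Suc.prems(1) True by blast
  next
    case False
    then obtain v where v: "v \<in> V" "card (nbrs V E v) < s"
      by auto
    let ?V = "V - {v} - nbrs V E v"
    \<comment> \<open>Removing \<open>v\<close> and its at most \<open>s - 1\<close> neighbours
      costs at most \<open>s\<close> vertices, the difference between \<open>s * Suc t\<close> and
      \<open>s * t\<close>.\<close>
    have "s * t < card ?V"
      using card_nonnbrs[OF Suc.prems(1) v(1), of E] v(2) Suc.prems(2) by simp
    with Suc.IH[of ?V] Suc.prems(1) consider p where "is_path ?V E (Suc s) p"
      | S where "S \<in> nsets ?V (Suc t)" "nsets S 2 \<inter> E = {}"
      by auto
    then show ?thesis
    proof cases
      case 1
      then have "is_path V E (Suc s) p"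
        unfolding is_path_def by blast
      then show ?thesis
        by blast
    next
      case 2
      then show ?thesis
        using independent_insert[OF Suc.prems(1) v(1)] by blast
    qed
  qed
qed

section \<open>Cycles versus complete graphs\<close>

lemma cycle_of_path:
  assumes "m \<ge> 3" "v \<in> V" "is_path (nbrs V E v) E (m - 1) p"
  shows "contains_copy \<lparr> verts = V, edges = E \<rparr> (cycle_graph m)"
proof -
  define c where "c = p(m - 1 := v)"
  have m: "{..<m} = insert (m - 1) {..<m - 1}"
    using assms(1) by auto
  have c: "c (m - 1) = v" "\<And>j. j < m - 1 \<Longrightarrow> c j = p j"
    by (auto simp: c_def)
  have cim: "c ` {..<m - 1} = p ` {..<m - 1}"
    using c by auto
  have sub: "p ` {..<m - 1} \<subseteq> nbrs V E v" and inj: "inj_on p {..<m - 1}"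
    using assms(3) by (auto simp: is_path_def)
  have "inj_on c {..<m - 1}"
    using inj c by (auto simp: inj_on_def)
  moreover have "v \<notin> p ` {..<m - 1}"
    using sub by (auto simp: nbrs_def)
  ultimately have "inj_on c {..<m}"
    unfolding m using cim c(1) by auto
  moreover have "c ` {..<m} \<subseteq> V"
    unfolding m using cim c(1) sub assms(2) by (auto simp: nbrs_def)
  moreover have "{c i, c (Suc i mod m)} \<in> E" if i: "i < m" for i
  proof -
    have spoke: "{v, p j} \<in> E" if "j < m - 1" for j
      using sub that by (auto simp: nbrs_def)
    \<comment> \<open>In turn: an edge of the path, the edge from its last vertex to
      \<open>v\<close>, and the wrap-around edge from \<open>v\<close> to
      \<open>p 0\<close>.\<close>
    consider "Suc i < m - 1" | "Suc i = m - 1" | "i = m - 1"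
      using i by linarith
    then show ?thesis
    proof cases
      case 1
      then show ?thesis
        using c(2) assms(3) by (auto simp: is_path_def)
    next
      case 2
      then have "c (Suc i mod m) = v" "c i = p i"
        using c assms(1) by auto
      then show ?thesis
        using spoke[of i] 2 by (simp add: insert_commute)
    next
      case 3
      then have "c (Suc i mod m) = p 0" "c i = v"
        using c assms(1) by auto
      then show ?thesis
        using spoke[of 0] assms(1) by simp
    qed
  qed
  ultimately show ?thesis
    unfolding contains_copy_cycle_iff by auto
qed

text \<open>The bound is the sum of the increments \<open>(m - 2) * j + 1\<close> over
  \<open>j < t\<close>, one for each step of the induction on \<open>t\<close>.\<close>

lemma cycle_or_independent:
  assumes "m \<ge> 3" "finite V" "(m - 2) * (t choose 2) + t \<le> card V"
  shows "contains_copy \<lparr> verts = V, edges = E \<rparr> (cycle_graph m) \<or>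
    (\<exists>S \<in> nsets V t. nsets S 2 \<inter> E = {})"
  using assms(2,3)
proof (induction t arbitrary: V)
  case 0
  have "{} \<in> nsets V 0" "nsets {} 2 \<inter> E = {}"
    by (auto simp: nsets_def)
  then show ?case
    by blast
next
  case (Suc t)
  then obtain v where v: "v \<in> V"
    by fastforce
  have choose: "Suc t choose 2 = t + (t choose 2)"
    by (simp add: numeral_2_eq_2)
  show ?case
  \<comment> \<open>This threshold is what \<open>path_or_independent\<close> asks of the
    neighbourhood of \<open>v\<close> when \<open>s = m - 2\<close>.\<close>
  proof (cases "(m - 2) * t < card (nbrs V E v)")
    case True
    have sub: "nbrs V E v \<subseteq> V"
      by (auto simp: nbrs_def)
    then have "finite (nbrs V E v)"
      using Suc.prems(1) finite_subset by blast
    from path_or_independent[OF this True] consider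
        p where "is_path (nbrs V E v) E (Suc (m - 2)) p"
      | S where "S \<in> nsets (nbrs V E v) (Suc t)" "nsets S 2 \<inter> E = {}"
      by blast
    then show ?thesis
    proof cases
      case 1
      moreover have "Suc (m - 2) = m - 1"
        using assms(1) by simp
      ultimately show ?thesis
        using cycle_of_path[OF assms(1) v] by auto
    next
      case 2
      then show ?thesis
        using nsets_mono[OF sub] by blast
    qed
  next
    case False
    let ?V = "V - {v} - nbrs V E v"
    \<comment> \<open>At most \<open>(m - 2) * t + 1\<close> vertices are removed, exactly the
      increment of the bound from \<open>t\<close> to \<open>Suc t\<close>.\<close>
    have "(m - 2) * (t choose 2) + t \<le> card ?V"
      using card_nonnbrs[OF Suc.prems(1) v, of E] False Suc.prems(2)
      by (simp add: choose algebra_simps)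
    with Suc.IH[of ?V] Suc.prems(1) consider
        "contains_copy \<lparr> verts = ?V, edges = E \<rparr> (cycle_graph m)"
      | S where "S \<in> nsets ?V t" "nsets S 2 \<inter> E = {}"
      by auto
    then show ?thesis
    proof cases
      case 1
      then have "contains_copy \<lparr> verts = V, edges = E \<rparr> (cycle_graph m)"
        by (rule contains_copy_mono) auto
      then show ?thesis
        by blast
    next
      case 2
      then show ?thesis
        using independent_insert[OF Suc.prems(1) v] by blast
    qed
  qed
qed

text \<open>The edges of colour 0 serve as \<open>E\<close>: a set independent for them has all its
  edges in colour 1, and any bijection onto it embeds the complete graph.\<close>

lemma arrows_cycle_complete:
  assumes "m \<ge> 3"
  shows "arrows ((m - 2) * (t choose 2) + t) [cycle_graph m, complete_graph t]"
  unfolding arrows_def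
proof
  let ?N = "(m - 2) * (t choose 2) + t"
  fix f assume "f \<in> edges (complete_graph ?N) \<rightarrow> {..<length [cycle_graph m, complete_graph t]}"
  then have f: "f e < 2" if "e \<in> nsets {..<?N} 2" for e
    using that by (auto simp: complete_graph_def numeral_2_eq_2)
  let ?E = "{e \<in> nsets {..<?N} 2. f e = 0}"
  have "\<exists>i<2. contains_copy (mono_graph {..<?N} f i) ([cycle_graph m, complete_graph t] ! i)"
  proof (cases "contains_copy \<lparr> verts = {..<?N}, edges = ?E \<rparr> (cycle_graph m)")
    case True
    then show ?thesis
      by (intro exI[of _ 0]) (simp add: mono_graph_def)
  next
    case False
    then obtain S where S: "S \<in> nsets {..<?N} t" "nsets S 2 \<inter> ?E = {}"
      using cycle_or_independent[OF assms, of "{..<?N}" t ?E] by auto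
    have sub: "S \<subseteq> {..<?N}" "finite S" "card S = t"
      using S(1) by (auto simp: nsets_def)
    then obtain \<phi> where \<phi>: "bij_betw \<phi> {..<t} S"
      using finite_same_card_bij[of "{..<t}" S] by auto
    have "f e = 1" if "e \<in> nsets S 2" for e
      using that S(2) f[of e] nsets_mono[OF sub(1), of 2] by (auto simp: less_2_cases_iff)
    moreover have "\<phi> ` e \<in> nsets S 2" if "e \<in> nsets {..<t} 2" for e
      using that bij_betw_nsets[OF \<phi>, of 2] by (auto simp: bij_betw_def)
    ultimately have "contains_copy (mono_graph {..<?N} f 1) (complete_graph t)"
      unfolding contains_copy_def mono_graph_def complete_graph_def
      using \<phi> sub(1) nsets_mono[OF sub(1), of 2]
      by (intro exI[of _ \<phi>]) (auto simp: bij_betw_def)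
    then show ?thesis
      by (intro exI[of _ 1]) simp
  qed
  then show "\<exists>i<length [cycle_graph m, complete_graph t].
      contains_copy (colour_class ?N f i) ([cycle_graph m, complete_graph t] ! i)"
    by (simp add: colour_class_eq_mono_graph numeral_2_eq_2)
qed

section \<open>The bounds on the diagonal Ramsey number\<close>

lemma real_choose_two: "real (t choose 2) = real t * (real t - 1) / 2"
  by (simp add: binomial_gbinomial gbinomial_prod_rev numeral_2_eq_2)

theorem theorem1p7:
  fixes k n :: nat
  assumes "k \<ge> 2" and "n \<ge> 4"
  shows "real (diag_ramsey_number k (wheel_graph n))
           \<le> real k * (real (ramsey_number (cycle_graph (n - 1) # replicate (k - 1) (wheel_graph n))) - 1) + 2
      \<and> real k * (real (ramsey_number (cycle_graph (n - 1) # replicate (k - 1) (wheel_graph n))) - 1) + 2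
           \<le> real k * (real (ramsey_number
                 [cycle_graph (n - 1), complete_graph (diag_ramsey_number (k - 1) (wheel_graph n))]) - 1) + 2
      \<and> real (diag_ramsey_number k (wheel_graph n))
           \<le> real k * ((real n - 3) / 2 * real (diag_ramsey_number (k - 1) (wheel_graph n))
                         * (real (diag_ramsey_number (k - 1) (wheel_graph n)) - 1)
                       + real (diag_ramsey_number (k - 1) (wheel_graph n)) - 1) + 2"
proof -
  define Gs where "Gs = cycle_graph (n - 1) # replicate (k - 1) (wheel_graph n)"
  define r where "r = ramsey_number Gs"
  define t where "t = diag_ramsey_number (k - 1) (wheel_graph n)"
  define q where "q = ramsey_number [cycle_graph (n - 1), complete_graph t]"
  have fin: "fin_sgraph (wheel_graph n)" "fin_sgraph (cycle_graph (n - 1))"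
    using assms(2) fin_sgraph_wheel fin_sgraph_cycle by auto
  have r: "arrows r Gs"
    unfolding r_def by (rule arrows_ramsey_number) (use fin in \<open>auto simp: Gs_def\<close>)
  \<comment> \<open>Positivity makes \<open>b\<close> the exact value of \<open>r - 1\<close>, in
    the naturals as in the reals.\<close>
  have "r > 0"
    using r by (rule arrows_pos)
      (use assms(2) in \<open>auto simp: Gs_def cycle_graph_def wheel_graph_def lessThan_empty_iff\<close>)
  then obtain b where b: "r = Suc b"
    using gr0_implies_Suc by blast
  have "diag_ramsey_number k (wheel_graph n) \<le> k * b + 2"
    unfolding diag_ramsey_number_def
    by (intro ramsey_number_le arrows_wheel_of_cycle) (use assms r b in \<open>auto simp: Gs_def\<close>)
  then have "real (diag_ramsey_number k (wheel_graph n)) \<le> real (k * b + 2)"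
    by (rule of_nat_mono)
  then have 1: "real (diag_ramsey_number k (wheel_graph n)) \<le> real k * (real r - 1) + 2"
    by (simp add: b)
  have "arrows t (replicate (k - 1) (wheel_graph n))"
    unfolding t_def diag_ramsey_number_def by (rule arrows_ramsey_number) (use fin in auto)
  moreover have "arrows q [cycle_graph (n - 1), complete_graph t]"
    unfolding q_def by (rule arrows_ramsey_number) (use fin fin_sgraph_complete in auto)
  \<comment> \<open>By merging colours, \<open>q\<close> arrows \<open>Gs\<close>, and
    \<open>r\<close> is the least such number.\<close>
  ultimately have "r \<le> q"
    unfolding r_def Gs_def by (blast intro: ramsey_number_le arrows_merge_colours)
  then have 2: "real k * (real r - 1) + 2 \<le> real k * (real q - 1) + 2"
    by (simp add: mult_left_mono)
  have "q \<le> (n - 1 - 2) * (t choose 2) + t"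
    unfolding q_def by (intro ramsey_number_le arrows_cycle_complete) (use assms(2) in simp)
  then have "real q \<le> real (n - 3) * real (t choose 2) + real t"
    by (simp flip: of_nat_mult of_nat_add add: numeral_3_eq_3)
  \<comment> \<open>Since \<open>n \<ge> 4\<close>, the subtraction in \<open>n - 3\<close> is not
    truncated; the factor 1/2 comes from the binomial coefficient.\<close>
  also have "\<dots> = (real n - 3) / 2 * real t * (real t - 1) + real t"
    using assms(2) by (simp add: real_choose_two of_nat_diff)
  finally have "real k * (real q - 1) + 2
      \<le> real k * ((real n - 3) / 2 * real t * (real t - 1) + real t - 1) + 2"
    by (intro add_right_mono mult_left_mono) auto
  \<comment> \<open>The third bound chains \<open>1\<close>, \<open>2\<close> and this estimate of
    \<open>q\<close>.\<close>
  then show ?thesis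
    using 1 2 unfolding r_def q_def Gs_def t_def by linarith
qed

end
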